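(* For $\sigma\in S_4$ the following (i), (ii) are equivalent: (i) $\sigma\in G$; (ii) $\sigma(a)=a$ for all $a\in\mathbb F\setminus\{0,1\}$.
   Context: $\mathbb F$ is an algebraically closed field of characteristic $0$. $S_4$ is the group of permutations of $\mathbb I=\{0,1,2,3\}$. $S_4$ acts on the set $\mathbb F\setminus\{0,1\}$: this is the unique action such that for all $a\in\mathbb F\setminus\{0,1\}$ the transposition $(2,0)$ sends $a\mapsto a^{-1}$, the transposition $(0,1)$ sends $a\mapsto a(a-1)^{-1}$, and the transposition $(1,3)$ sends $a\mapsto a^{-1}$. The notation $\sigma(a)$ refers to this action. $G$ is the kernel of the action of $S_4$ on the three partitions of $\mathbb I$ into two disjoint two-element subsets; thus $G$ consists of the identity and $(01)(23)$, $(02)(13)$, $(03)(12)$. *)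

theory Defs
  imports
    "HOL-Combinatorics.Permutations"
    "HOL-Computational_Algebra.Polynomial"
    "HOL-Library.Disjoint_Sets"
    "HOL-Algebra.Group_Action"
begin

definition \<II> :: "nat set"
  where "\<II> = {0, 1, 2, 3}"

definition S4 :: "(nat \<Rightarrow> nat) monoid"
  where "S4 = \<lparr>carrier = {\<sigma>. \<sigma> permutes \<II>}, mult = (\<circ>), one = id\<rparr>"

definition pairings :: "nat set set set"
  where "pairings = {P. partition_on \<II> P \<and> (\<forall>B\<in>P. card B = 2)}"

definition pairing_act :: "(nat \<Rightarrow> nat) \<Rightarrow> nat set set \<Rightarrow> nat set set"
  where "pairing_act \<sigma> = (\<lambda>P\<in>pairings. (\<lambda>B. \<sigma> ` B) ` P)"

definition G4 :: "(nat \<Rightarrow> nat) set"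
  where "G4 = kernel S4 (BijGroup pairings) pairing_act"

(* Membership in extensional only pins down the values on functions that are not in S4,
   so that the action is unique as a HOL function. *)
definition is_S4_act :: "((nat \<Rightarrow> nat) \<Rightarrow> 'a::field \<Rightarrow> 'a) \<Rightarrow> bool"
  where "is_S4_act \<phi> \<longleftrightarrow>
    group_action S4 (UNIV - {0, 1}) \<phi> \<and> \<phi> \<in> extensional (carrier S4) \<and>
    (\<forall>a\<in>UNIV - {0, 1}.
       \<phi> (transpose 2 0) a = inverse a \<and>
       \<phi> (transpose 0 1) a = a * inverse (a - 1) \<and>
       \<phi> (transpose 1 3) a = inverse a)"

definition S4_act :: "(nat \<Rightarrow> nat) \<Rightarrow> 'a::field \<Rightarrow> 'a"
  where "S4_act = (THE \<phi>. is_S4_act \<phi>)"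


subsection \<open>Well-definedness of the action\<close>

lemma finite_\<II>: "finite \<II>"
  by (simp add: \<II>_def)

lemma group_S4: "group S4"
proof (rule groupI)
  fix x assume "x \<in> carrier S4"
  then show "\<exists>y\<in>carrier S4. y \<otimes>\<^bsub>S4\<^esub> x = \<one>\<^bsub>S4\<^esub>"
    by (auto simp: S4_def intro!: bexI[of _ "inv_into UNIV x"] permutes_inv_o permutes_inv)
qed (auto simp: S4_def permutes_compose permutes_id comp_assoc)

(* Up to signs and a common factor, a and 1 - a and -1 are the three products of differences of four
   points with cross ratio a; they are indexed here by the pairing containing {i, j}. *)
definition crT :: "'a::field \<Rightarrow> nat \<Rightarrow> nat \<Rightarrow> 'a"
  where "crT a i j =
    (if (i, j) \<in> {(0, 1), (1, 0), (2, 3), (3, 2)} then a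
     else if (i, j) \<in> {(0, 2), (2, 0), (1, 3), (3, 1)} then 1 - a else - 1)"

definition cr_perm :: "(nat \<Rightarrow> nat) \<Rightarrow> 'a::field \<Rightarrow> 'a"
  where "cr_perm q a = - crT a (q 0) (q 1) / crT a (q 0) (q 3)"

lemma crT_nonzero: "a \<noteq> 0 \<Longrightarrow> a \<noteq> 1 \<Longrightarrow> crT a i j \<noteq> 0"
  by (auto simp: crT_def)

lemma crT_cases:
  assumes "distinct [p0, p1, p2, p3]" "{p0, p1, p2, p3} \<subseteq> {0, 1, 2, 3}"
  shows "crT a p0 p1 + crT a p0 p2 + crT a p0 p3 = 0"
    "crT a p2 p3 = crT a p0 p1" "crT a p1 p3 = crT a p0 p2" "crT a p1 p2 = crT a p0 p3"
proof -
  have "p0 = 0 \<or> p0 = 1 \<or> p0 = 2 \<or> p0 = 3" "p1 = 0 \<or> p1 = 1 \<or> p1 = 2 \<or> p1 = 3"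
    "p2 = 0 \<or> p2 = 1 \<or> p2 = 2 \<or> p2 = 3" "p3 = 0 \<or> p3 = 1 \<or> p3 = 2 \<or> p3 = 3"
    using assms(2) by auto
  then have "crT a p0 p1 + crT a p0 p2 + crT a p0 p3 = 0 \<and> crT a p2 p3 = crT a p0 p1 \<and>
      crT a p1 p3 = crT a p0 p2 \<and> crT a p1 p2 = crT a p0 p3"
    using assms(1) by (elim disjE) (simp_all add: crT_def)
  then show "crT a p0 p1 + crT a p0 p2 + crT a p0 p3 = 0"
    "crT a p2 p3 = crT a p0 p1" "crT a p1 p3 = crT a p0 p2" "crT a p1 p2 = crT a p0 p3"
    by auto
qed

lemma crT_commute: "crT a i j = crT a j i"
  by (auto simp: crT_def)

lemma permutes_\<II>:
  assumes "q permutes \<II>"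
  shows "distinct [q 0, q 1, q 2, q 3]" "{q 0, q 1, q 2, q 3} \<subseteq> {0, 1, 2, 3}"
proof -
  have "inj q" using assms by (rule permutes_inj)
  then show "distinct [q 0, q 1, q 2, q 3]" by (simp add: inj_eq)
  have "q ` \<II> = \<II>" using assms by (rule permutes_image)
  then show "{q 0, q 1, q 2, q 3} \<subseteq> {0, 1, 2, 3}" by (auto simp: \<II>_def)
qed

lemma cr_perm_closed:
  assumes q: "q permutes \<II>" and a: "a \<noteq> 0" "a \<noteq> 1"
  shows "cr_perm q a \<noteq> 0" "cr_perm q a \<noteq> 1"
proof -
  have nz: "crT a (q 0) (q j) \<noteq> 0" for j
    using a by (rule crT_nonzero)
  then show "cr_perm q a \<noteq> 0" by (simp add: cr_perm_def)
  show "cr_perm q a \<noteq> 1"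
  proof
    assume "cr_perm q a = 1"
    then have "- crT a (q 0) (q 1) = crT a (q 0) (q 3)"
      unfolding cr_perm_def using right_inverse_eq[OF nz] by blast
    then have "crT a (q 0) (q 1) + crT a (q 0) (q 3) = 0"
      by (metis add.right_inverse)
    moreover have "crT a (q 0) (q 1) + crT a (q 0) (q 2) + crT a (q 0) (q 3) = 0"
      by (rule crT_cases(1)[OF permutes_\<II>[OF q]])
    ultimately have "crT a (q 0) (q 2) = 0" by (metis add.commute add.left_commute add_0_right)
    then show False using nz by simp
  qed
qed

lemma crT_cr:
  assumes q: "q permutes \<II>" and a: "a \<noteq> 0" "a \<noteq> 1" and ij: "i \<in> \<II>" "j \<in> \<II>" "i \<noteq> j"
  shows "crT (cr_perm q a) i j = - crT a (q i) (q j) / crT a (q 0) (q 3)"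
proof -
  define D where "D = crT a (q 0) (q 3)"
  have D: "D \<noteq> 0" using a by (simp add: D_def crT_nonzero)
  note c = crT_cases[OF permutes_\<II>[OF q], of a, folded D_def]
  have e: "crT a (q 0) (q 2) = - crT a (q 0) (q 1) - D"
    using c(1) by (simp add: algebra_simps eq_neg_iff_add_eq_0)
  have r: "1 - cr_perm q a = - crT a (q 0) (q 2) / D"
    using D by (simp add: cr_perm_def e D_def[symmetric] field_simps)
  have ord: "(i, j) \<in> {(0,1),(0,2),(0,3),(1,2),(1,3),(2,3),(1,0),(2,0),(3,0),(2,1),(3,1),(3,2)}"
    using ij by (auto simp: \<II>_def)
  have v: "crT b 0 1 = b" "crT b 2 3 = b" "crT b 0 2 = 1 - b" "crT b 1 3 = 1 - b" "crT b 0 3 = -1"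
    "crT b 1 2 = -1" for b :: 'a
    by (auto simp: crT_def)
  have s: "crT b 1 0 = b" "crT b 3 2 = b" "crT b 2 0 = 1 - b" "crT b 3 1 = 1 - b" "crT b 3 0 = -1"
    "crT b 2 1 = -1" for b :: 'a
    by (auto simp: crT_def)
  have t: "crT a (q 1) (q 0) = crT a (q 0) (q 1)" "crT a (q 3) (q 2) = crT a (q 0) (q 1)"
    "crT a (q 2) (q 0) = crT a (q 0) (q 2)" "crT a (q 3) (q 1) = crT a (q 0) (q 2)"
    "crT a (q 3) (q 0) = D" "crT a (q 2) (q 1) = D"
    using c crT_commute[of a] D_def by metis+
  have w: "crT a (q 0) (q 1) = - D * cr_perm q a"
    using D by (simp add: cr_perm_def D_def[symmetric])
  show ?thesis
    using ord D unfolding D_def[symmetric]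
    by (elim insertE emptyE; simp add: v s c t r w D_def[symmetric] del: One_nat_def)
qed

lemma cr_perm_compose:
  assumes p: "p permutes \<II>" and q: "q permutes \<II>" and a: "a \<noteq> 0" "a \<noteq> 1"
  shows "cr_perm p (cr_perm q a) = cr_perm (q \<circ> p) a"
proof -
  have in_I: "p j \<in> \<II>" if "j \<in> \<II>" for j
    using permutes_in_image[OF p] that by blast
  have "p 0 \<noteq> p 1" "p 0 \<noteq> p 3" using permutes_\<II>(1)[OF p] by auto
  then have *: "crT (cr_perm q a) (p 0) (p j) = - crT a (q (p 0)) (q (p j)) / crT a (q 0) (q 3)"
    if "j \<in> {1, 3}" for j
    using that by (intro crT_cr q a in_I) (auto simp: \<II>_def)
  have "crT a (q 0) (q 3) \<noteq> 0" using a by (rule crT_nonzero)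
  then show ?thesis by (simp add: cr_perm_def[of p] cr_perm_def[of "q \<circ> p"] *)
qed

lemma cr_perm_id: "cr_perm id a = a"
  by (auto simp: cr_perm_def crT_def)

definition S4_cr :: "(nat \<Rightarrow> nat) \<Rightarrow> 'a::field \<Rightarrow> 'a"
  where "S4_cr = (\<lambda>\<sigma>\<in>carrier S4. \<lambda>a\<in>UNIV - {0, 1}. cr_perm (inv_into UNIV \<sigma>) a)"

lemma S4_cr_Bij:
  assumes "\<sigma> permutes \<II>"
  shows "S4_cr \<sigma> \<in> Bij (UNIV - {0, 1})"
proof -
  have inv: "inv_into UNIV \<sigma> permutes \<II>" using assms by (rule permutes_inv)
  have "bij_betw (cr_perm (inv_into UNIV \<sigma>)) (UNIV - {0, 1::'a}) (UNIV - {0, 1})"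
  proof (rule bij_betwI[where g = "cr_perm \<sigma>"])
    show "cr_perm (inv_into UNIV \<sigma>) \<in> UNIV - {0, 1::'a} \<rightarrow> UNIV - {0, 1}"
      using cr_perm_closed[OF inv] by auto
    show "cr_perm \<sigma> \<in> UNIV - {0, 1::'a} \<rightarrow> UNIV - {0, 1}"
      using cr_perm_closed[OF assms] by auto
  qed (auto simp: cr_perm_compose assms inv permutes_inv_o[OF assms] cr_perm_id)
  then have "bij_betw (S4_cr \<sigma>) (UNIV - {0, 1::'a}) (UNIV - {0, 1})"
    using assms by (subst bij_betw_cong[where g = "cr_perm (inv_into UNIV \<sigma>)"])
      (auto simp: S4_cr_def S4_def)
  then show ?thesis using assms by (simp add: Bij_def S4_cr_def S4_def)
qed

lemma is_S4_act_S4_cr: "is_S4_act S4_cr"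
proof -
  have hom: "S4_cr \<in> hom S4 (BijGroup (UNIV - {0, 1::'a}))"
  proof (rule homI)
    fix x assume "x \<in> carrier S4"
    then show "S4_cr x \<in> carrier (BijGroup (UNIV - {0, 1::'a}))"
      by (simp add: BijGroup_def S4_cr_Bij S4_def)
  next
    fix x y assume "x \<in> carrier S4" "y \<in> carrier S4"
    then have x: "x permutes \<II>" and y: "y permutes \<II>" by (auto simp: S4_def)
    have inv: "inv_into UNIV (x \<circ> y) = inv_into UNIV y \<circ> inv_into UNIV x"
      using x y by (simp add: o_inv_distrib permutes_bij)
    have "S4_cr (x \<circ> y) = compose (UNIV - {0, 1::'a}) (S4_cr x) (S4_cr y)"
      using x y cr_perm_closed[OF permutes_inv[OF y]]
      by (auto simp: fun_eq_iff S4_cr_def S4_def compose_def restrict_def permutes_compose inv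
          cr_perm_compose permutes_inv)
    then show "S4_cr (x \<otimes>\<^bsub>S4\<^esub> y) =
        S4_cr x \<otimes>\<^bsub>BijGroup (UNIV - {0, 1::'a})\<^esub> S4_cr y"
      using x y by (simp add: BijGroup_def S4_cr_Bij S4_def)
  qed
  have "group_action S4 (UNIV - {0, 1::'a}) S4_cr"
    using hom group_S4 group_BijGroup
    by (simp add: group_action_def group_hom_def group_hom_axioms_def)
  moreover have "transpose 2 0 permutes \<II>" "transpose 0 1 permutes \<II>" "transpose 1 3 permutes \<II>"
    by (auto intro!: permutes_swap_id simp: \<II>_def)
  ultimately show ?thesis
    by (auto simp: is_S4_act_def S4_cr_def S4_def cr_perm_def crT_def transpose_def
        field_simps)
qed

lemma is_S4_act_unique:
  fixes \<phi> \<psi> :: "(nat \<Rightarrow> nat) \<Rightarrow> 'a::field \<Rightarrow> 'a"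
  assumes \<phi>: "is_S4_act \<phi>" and \<psi>: "is_S4_act \<psi>"
  shows "\<phi> = \<psi>"
proof -
  define A where "A = {\<sigma>. \<sigma> permutes \<II> \<and> \<phi> \<sigma> = \<psi> \<sigma>}"
  interpret f: group_hom S4 "BijGroup (UNIV - {0, 1::'a})" \<phi>
    using \<phi> by (simp add: is_S4_act_def group_action_def)
  interpret g: group_hom S4 "BijGroup (UNIV - {0, 1::'a})" \<psi>
    using \<psi> by (simp add: is_S4_act_def group_action_def)
  have ext: "\<phi> \<sigma> \<in> extensional (UNIV - {0, 1})" "\<psi> \<sigma> \<in> extensional (UNIV - {0, 1})"
    if "\<sigma> permutes \<II>" for \<sigma>
    using that f.hom_closed g.hom_closed by (auto simp: S4_def BijGroup_def Bij_def)
  have comp: "x \<circ> y \<in> A" if "x \<in> A" "y \<in> A" for x y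
    using that f.hom_mult[of x y] g.hom_mult[of x y]
    by (auto simp: A_def S4_def permutes_compose)
  have id: "id \<in> A"
    using f.hom_one g.hom_one by (auto simp: A_def S4_def permutes_id)
  have perm: "transpose a b permutes \<II>" if "a \<in> \<II>" "b \<in> \<II>" for a b
    using that by (rule permutes_swap_id)
  have A_I: "\<sigma> \<in> A" if "\<sigma> permutes \<II>" "\<forall>a\<in>UNIV - {0, 1}. \<phi> \<sigma> a = \<psi> \<sigma> a" for \<sigma>
    using that extensionalityI[OF ext[OF that(1)]] by (auto simp: A_def)
  have gen: "transpose 2 0 \<in> A" "transpose 0 1 \<in> A" "transpose 1 3 \<in> A"
    using \<phi> \<psi> unfolding is_S4_act_def
    by (intro A_I perm ballI; simp add: \<II>_def del: One_nat_def)+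
  have conj: "transpose a c \<in> A"
    if "transpose a b \<in> A" "transpose b c \<in> A" "a \<noteq> b" "b \<noteq> c" "a \<noteq> c" for a b c
  proof -
    have "transpose a c = transpose a b \<circ> (transpose b c \<circ> transpose a b)"
      using that(3-5) by (auto simp: fun_eq_iff transpose_def)
    then show ?thesis using comp[OF that(1) comp[OF that(2) that(1)]] by simp
  qed
  have t21: "transpose 2 1 \<in> A" using conj[OF gen(1,2)] by simp
  have t03: "transpose 0 3 \<in> A" using conj[OF gen(2,3)] by simp
  have t23: "transpose 2 3 \<in> A" using conj[OF gen(1) t03] by simp
  have trans: "transpose a b \<in> A" if "a \<in> \<II>" "b \<in> \<II>" "a \<noteq> b" for a b
    using that gen t21 t03 t23 by (auto simp: \<II>_def transpose_commute)
  have "\<sigma> \<in> A" if "\<sigma> permutes \<II>" for \<sigma>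
    using that finite_\<II>
    by (induction rule: permutes_induct) (blast intro: id comp trans)+
  then show ?thesis
    using \<phi> \<psi> by (intro extensionalityI[of _ "carrier S4"])
      (auto simp: is_S4_act_def A_def S4_def)
qed

lemma ex1_S4_act: "\<exists>!\<phi>. is_S4_act \<phi>"
  using is_S4_act_S4_cr is_S4_act_unique by blast

lemma is_S4_act_S4_act: "is_S4_act S4_act"
  unfolding S4_act_def by (rule theI'[OF ex1_S4_act])

end

theory Submission
  imports Defs
begin

text \<open>
  Let \<open>q = \<sigma>\<inverse>\<close>. Then \<open>\<sigma>(a) = - crT a (q 0) (q 1) / crT a (q 0) (q 3)\<close>, where \<open>crT a i j\<close> depends
  only on the pairing of \<open>\<II>\<close> that contains \<open>{i, j}\<close>; so a permutation that fixes the three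
  pairings acts trivially. Conversely, at \<open>a = 3\<close> the pairings have the values \<open>3, -2, -1\<close>, and
  \<open>-3\<close> is the quotient of two of these only as \<open>3 / (-1)\<close>. Hence if \<open>3\<close> is fixed then \<open>q\<close> fixes
  the pairings of \<open>{0, 1}\<close> and \<open>{0, 3}\<close>, and therefore all three of them.
\<close>

text \<open>A pairing is determined by the partner \<open>k\<close> of 0, because its other block
  must be the complement of \<open>{0, k}\<close>.\<close>

lemma pairings_eq:
  "pairings = {{{0, 1}, {2, 3}}, {{0, 2}, {1, 3}}, {{0, 3}, {1, 2}}}" (is "_ = ?R")
proof
  show "pairings \<subseteq> ?R"
  proof
    fix P assume "P \<in> pairings"
    then have P: "partition_on \<II> P" and two: "\<And>B. B \<in> P \<Longrightarrow> card B = 2"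
      by (auto simp: pairings_def)
    have un: "\<Union> P = \<II>" and disj: "\<And>B C. B \<in> P \<Longrightarrow> C \<in> P \<Longrightarrow> B \<noteq> C \<Longrightarrow> B \<inter> C = {}"
      using P by (auto simp: partition_on_def disjoint_def)
    have "0 \<in> \<Union> P" by (simp add: un \<II>_def)
    then obtain B where B: "B \<in> P" "0 \<in> B" by blast
    have B_sub: "B \<subseteq> \<II>" using B un by blast
    obtain k where k: "B = {0, k}" "k \<noteq> 0"
      using two[OF B(1)] B(2) by (auto simp: card_2_iff)
    have card: "card (\<II> - B) = 2"
    proof -
      have "card (\<II> - B) = card \<II> - card B"
        using finite_subset[OF B_sub finite_\<II>] B_sub by (rule card_Diff_subset)
      then show ?thesis using two[OF B(1)] by (simp add: \<II>_def)
    qed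
    have other: "C = \<II> - B" if "C \<in> P" "C \<noteq> B" for C
    proof (rule card_subset_eq)
      show "C \<subseteq> \<II> - B" using that B(1) disj un by blast
      show "finite (\<II> - B)" using finite_\<II> by (rule finite_Diff)
      show "card C = card (\<II> - B)" using two[OF that(1)] card by (rule trans[OF _ sym])
    qed
    have "\<II> - B \<in> P"
    proof -
      obtain x where "x \<in> \<II> - B" using card card_2_iff' by metis
      then show ?thesis using un other by (metis DiffD1 DiffD2 UnionE)
    qed
    then have "P = {B, \<II> - B}" using other B(1) by blast
    moreover have "k = 1 \<or> k = 2 \<or> k = 3" using k B_sub by (auto simp: \<II>_def)
    moreover have "\<II> - {0, 1} = {2, 3}" "\<II> - {0, 2} = {1, 3}" "\<II> - {0, 3} = {1, 2}"
      by (auto simp: \<II>_def)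
    ultimately show "P \<in> ?R" unfolding k(1) by (elim disjE) simp_all
  qed
  show "?R \<subseteq> pairings"
    by (auto simp: pairings_def partition_on_def disjoint_def \<II>_def)
qed

text \<open>The unit of \<open>BijGroup pairings\<close> is the identity restricted to
  \<open>pairings\<close>, so lying in the kernel is a condition on values at pairings only.\<close>

lemma G4_iff:
  "\<sigma> \<in> G4 \<longleftrightarrow> \<sigma> permutes \<II> \<and> (\<forall>P\<in>pairings. (`) \<sigma> ` P = P)"
proof -
  have "pairing_act \<sigma> = (\<lambda>P\<in>pairings. P) \<longleftrightarrow> (\<forall>P\<in>pairings. (`) \<sigma> ` P = P)"
    unfolding pairing_act_def by (metis restrict_apply' restrict_ext)
  then show ?thesis by (simp add: G4_def kernel_def S4_def BijGroup_def)
qed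

text \<open>These are the value tuples of the identity and of (01)(23), (02)(13), (03)(12). Tuples
  let simp decide membership in each of the 24 cases below.\<close>

definition klein_four_tuples :: "(nat \<times> nat \<times> nat \<times> nat) set"
  where "klein_four_tuples = {(0, 1, 2, 3), (1, 0, 3, 2), (2, 3, 0, 1), (3, 2, 1, 0)}"

lemma permutes_\<II>_tuple_cases:
  assumes "q permutes \<II>"
  shows "(q 0, q 1, q 2, q 3) \<in>
    {(0,1,2,3), (0,1,3,2), (0,2,1,3), (0,2,3,1), (0,3,1,2), (0,3,2,1),
     (1,0,2,3), (1,0,3,2), (1,2,0,3), (1,2,3,0), (1,3,0,2), (1,3,2,0),
     (2,0,1,3), (2,0,3,1), (2,1,0,3), (2,1,3,0), (2,3,0,1), (2,3,1,0),
     (3,0,1,2), (3,0,2,1), (3,1,0,2), (3,1,2,0), (3,2,0,1), (3,2,1,0)}"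
proof -
  have "q 0 \<in> {0,1,2,3}" "q 1 \<in> {0,1,2,3}" "q 2 \<in> {0,1,2,3}" "q 3 \<in> {0,1,2,3}"
    using permutes_\<II>(2)[OF assms] by auto
  then show ?thesis
    using permutes_\<II>(1)[OF assms]
    unfolding insert_iff empty_iff
    by (elim disjE FalseE; simp)
qed

lemma fixes_pairings_iff:
  assumes "q permutes \<II>"
  shows "(\<forall>P\<in>pairings. (`) q ` P = P) \<longleftrightarrow> (q 0, q 1, q 2, q 3) \<in> klein_four_tuples"
  using permutes_\<II>_tuple_cases[OF assms]
  by (elim insertE emptyE;
      simp add: pairings_eq klein_four_tuples_def doubleton_eq_iff del: One_nat_def)

text \<open>In each case \<open>{q 0, q 1}\<close> lies in the pairing of \<open>{0, 1}\<close> and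
  \<open>{q 0, q 3}\<close> in that of \<open>{0, 3}\<close>, so the quotient is
  \<open>- a / (- 1)\<close>.\<close>

lemma cr_perm_klein:
  assumes "(q 0, q 1, q 2, q 3) \<in> klein_four_tuples"
  shows "cr_perm q a = a"
  using assms
  by (auto simp: klein_four_tuples_def cr_perm_def crT_def)

text \<open>Over the 24 cases \<open>cr_perm q 3\<close> takes the values 3, 1/3, -2, -1/2, 3/2,
  2/3, which are distinct in characteristic 0; the value 3 occurs exactly at the Klein
  tuples.\<close>

lemma klein_if_cr_perm_three:
  assumes "q permutes \<II>" and "cr_perm q (3 :: 'a::field_char_0) = 3"
  shows "(q 0, q 1, q 2, q 3) \<in> klein_four_tuples"
  using permutes_\<II>_tuple_cases[OF assms(1)] assms(2)
  by (elim insertE emptyE;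
      simp add: klein_four_tuples_def cr_perm_def crT_def field_simps del: One_nat_def)

text \<open>Uniqueness of the action replaces the definite description by the explicit
  formula.\<close>

lemma S4_act_eq:
  fixes a :: "'a::field"
  assumes "\<sigma> permutes \<II>" "a \<noteq> 0" "a \<noteq> 1"
  shows "S4_act \<sigma> a = cr_perm (inv_into UNIV \<sigma>) a"
proof -
  have "S4_act = (S4_cr :: _ \<Rightarrow> 'a \<Rightarrow> 'a)"
    using is_S4_act_S4_act is_S4_act_S4_cr by (rule is_S4_act_unique)
  then have "S4_act \<sigma> a = S4_cr \<sigma> a" by (rule fun_cong[OF fun_cong])
  also have "\<dots> = cr_perm (inv_into UNIV \<sigma>) a"
    using assms by (simp add: S4_cr_def S4_def)
  finally show ?thesis .
qed

text \<open>The two maps are mutually inverse, hence have the same fixed points. This allows testing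
  the tuple of \<open>\<sigma>\<close> itself instead of that of its inverse.\<close>

lemma cr_perm_inv_fixed_iff:
  assumes "\<sigma> permutes \<II>" "a \<noteq> 0" "a \<noteq> 1"
  shows "cr_perm (inv_into UNIV \<sigma>) a = a \<longleftrightarrow> cr_perm \<sigma> a = a"
  using cr_perm_compose[OF assms(1) permutes_inv[OF assms(1)] assms(2,3)]
    cr_perm_compose[OF permutes_inv[OF assms(1)] assms(1) assms(2,3)]
  by (metis assms(1) cr_perm_id permutes_inv_o)

theorem lemma8p2:
  fixes \<sigma> :: "nat \<Rightarrow> nat"
  assumes "\<sigma> \<in> carrier S4"
  shows "\<sigma> \<in> G4 \<longleftrightarrow>
    (\<forall>a\<in>UNIV - {0, 1 :: 'a::{alg_closed_field, field_char_0}}. S4_act \<sigma> a = a)"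
proof -
  have \<sigma>: "\<sigma> permutes \<II>" using assms by (simp add: S4_def)
  have act: "S4_act \<sigma> a = a \<longleftrightarrow> cr_perm \<sigma> a = a" if "a \<in> UNIV - {0, 1 :: 'a}" for a
    using that \<sigma> by (simp add: S4_act_eq cr_perm_inv_fixed_iff)
  have G4: "\<sigma> \<in> G4 \<longleftrightarrow> (\<sigma> 0, \<sigma> 1, \<sigma> 2, \<sigma> 3) \<in> klein_four_tuples"
    using \<sigma> by (simp add: G4_iff fixes_pairings_iff)
  \<comment> \<open>Characteristic 0 makes 3 an admissible test point for the converse.\<close>
  have "(3 :: 'a) \<in> UNIV - {0, 1}" by simp
  then show ?thesis
    using G4 act cr_perm_klein klein_if_cr_perm_three[OF \<sigma>] by metis
qed

end
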